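(* Let $h$ be a real-valued summary of datasets with sensitivity $\Delta=\sup_{D\sim D'}|h(D)-h(D')|$. Let $\theta>0$ and let $\sigma>0$ satisfy $\sigma\ge\Delta/\theta$. Then the Gaussian mechanism $$f_D(x)=\frac{1}{\sqrt{2\pi\sigma^2}}\exp\left\{-\frac{(x-h(D))^2}{2\sigma^2}\right\},\qquad x\in\mathbb{R},$$ satisfies $\theta$-Rao differential privacy, i.e. $d_R(f_D,f_{D'})\le\theta$ for all adjacent datasets $D\sim D'$, where $d_R$ is the Rao distance in the family of Gaussian densities with fixed standard deviation $\sigma$.
   Context: Datasets: $D=\{x_1,\dots,x_n\}$ with $x_i\in\mathcal{X}$ and $n$ fixed. Two datasets $D,D'$ are adjacent, written $D\sim D'$, if $|D|=|D'|$ and they differ in exactly one observation. Rao distance: for fixed $\sigma>0$ consider the one-parameter family $\{p(\cdot;\mu):\mu\in\mathbb{R}\}$ of Gaussian densities $p(x;\mu)=(2\pi\sigma^2)^{-1/2}\exp\{-(x-\mu)^2/(2\sigma^2)\}$. Its Fisher information is $g(\mu)=\mathbb{E}_{x\sim p(\cdot;\mu)}\big[(\partial_\mu\ln p(x;\mu))^2\big]$, regarded as a Riemannian metric on the parameter space $\mathbb{R}$. The Rao distance $d_R(p(\cdot;\mu_1),p(\cdot;\mu_2))$ is the Riemannian distance between $\mu_1$ and $\mu_2$, i.e. the infimum of $\int_0^1\sqrt{g(\alpha(t))}\,|\dot\alpha(t)|\,dt$ over smooth paths $\alpha:[0,1]\to\mathbb{R}$ with $\alpha(0)=\mu_1$,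 $\alpha(1)=\mu_2$. Rao differential privacy: a mechanism $f_D$ satisfies $\theta$-Rao differential privacy if $d_R(f_D,f_{D'})\le\theta$ for all $D\sim D'$. *)

theory Defs
  imports "HOL-Probability.Probability"
begin

text \<open>Datasets of size \<open>n\<close> are modelled as \<open>n\<close>-tuples (lists of length \<open>n\<close>) of observations
  from \<open>X\<close>, so that repeated observations are allowed.\<close>

definition datasets :: "'a set \<Rightarrow> nat \<Rightarrow> 'a list set" where
  "datasets X n = {D. set D \<subseteq> X \<and> length D = n}"

definition adjacent :: "'a list \<Rightarrow> 'a list \<Rightarrow> bool" where
  "adjacent D D' \<longleftrightarrow> length D = length D' \<and> card {i. i < length D \<and> D ! i \<noteq> D' ! i} = 1"

definition adjacent_datasets :: "'a set \<Rightarrow> nat \<Rightarrow> ('a list \<times> 'a list) set" where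
  "adjacent_datasets X n = {(D, D'). D \<in> datasets X n \<and> D' \<in> datasets X n \<and> adjacent D D'}"

text \<open>Taken in \<^typ>\<open>ennreal\<close>: the value is \<open>\<infinity>\<close> if the differences are unbounded, and \<open>0\<close> if
  there are no adjacent datasets.\<close>

definition sensitivity :: "'a set \<Rightarrow> nat \<Rightarrow> ('a list \<Rightarrow> real) \<Rightarrow> ennreal" where
  "sensitivity X n h = (SUP (D, D') \<in> adjacent_datasets X n. ennreal \<bar>h D - h D'\<bar>)"

text \<open>For a one-parameter family \<open>p\<close> of densities, \<open>p \<mu> x\<close> is the value at \<open>x\<close> of the density
  with parameter \<open>\<mu>\<close>. The definition is meaningful for regular families, where the score exists
  and is square integrable, such as the Gaussian family with fixed positive standard deviation.\<close>

definition fisher_information :: "(real \<Rightarrow> real \<Rightarrow> real) \<Rightarrow> real \<Rightarrow> real" where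
  "fisher_information p \<mu> =
     (\<integral>x. (deriv (\<lambda>m. ln (p m x)) \<mu>)\<^sup>2 \<partial>density lborel (\<lambda>x. ennreal (p \<mu> x)))"

text \<open>Smoothness on the closed unit interval, with one-sided derivatives at the end points:
  \<open>d k\<close> is the \<open>k\<close>-th derivative.\<close>

definition smooth_path :: "(real \<Rightarrow> real) \<Rightarrow> bool" where
  "smooth_path \<alpha> \<longleftrightarrow> (\<exists>d :: nat \<Rightarrow> real \<Rightarrow> real. d 0 = \<alpha> \<and>
     (\<forall>k. \<forall>t\<in>{0..1}. (d k has_real_derivative d (Suc k) t) (at t within {0..1})))"

text \<open>\<open>g\<close> is a Riemannian metric on the real line, given by its single coefficient.\<close>

definition riemannian_length :: "(real \<Rightarrow> real) \<Rightarrow> (real \<Rightarrow> real) \<Rightarrow> ennreal" where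
  "riemannian_length g \<alpha> =
     (\<integral>\<^sup>+t\<in>{0..1}. ennreal (sqrt (g (\<alpha> t)) * \<bar>vector_derivative \<alpha> (at t within {0..1})\<bar>) \<partial>lborel)"

definition riemannian_dist :: "(real \<Rightarrow> real) \<Rightarrow> real \<Rightarrow> real \<Rightarrow> ennreal" where
  "riemannian_dist g \<mu>\<^sub>1 \<mu>\<^sub>2 =
     (INF \<alpha> \<in> {\<alpha>. smooth_path \<alpha> \<and> \<alpha> 0 = \<mu>\<^sub>1 \<and> \<alpha> 1 = \<mu>\<^sub>2}. riemannian_length g \<alpha>)"

text \<open>The Rao distance is a distance between members of the family \<open>p\<close>. If \<open>p\<close> is injective in
  its parameter, then the outer infimum is over the single pair of parameters of the two densities
  (see \<open>rao_dist_normal_density\<close> below). It is \<open>\<infinity>\<close> if one of the functions is not in the family.\<close>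

definition rao_dist :: "(real \<Rightarrow> real \<Rightarrow> real) \<Rightarrow> (real \<Rightarrow> real) \<Rightarrow> (real \<Rightarrow> real) \<Rightarrow> ennreal" where
  "rao_dist p f f' =
     (INF (\<mu>\<^sub>1, \<mu>\<^sub>2) \<in> {(\<mu>\<^sub>1, \<mu>\<^sub>2). p \<mu>\<^sub>1 = f \<and> p \<mu>\<^sub>2 = f'}. riemannian_dist (fisher_information p) \<mu>\<^sub>1 \<mu>\<^sub>2)"

text \<open>A mechanism is given by the density \<open>f D\<close> of its output for each dataset \<open>D\<close>.\<close>

definition rao_differentially_private ::
    "(real \<Rightarrow> real \<Rightarrow> real) \<Rightarrow> 'a set \<Rightarrow> nat \<Rightarrow> real \<Rightarrow> ('a list \<Rightarrow> real \<Rightarrow> real) \<Rightarrow> bool" where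
  "rao_differentially_private p X n \<theta> f \<longleftrightarrow>
     (\<forall>(D, D') \<in> adjacent_datasets X n. rao_dist p (f D) (f D') \<le> ennreal \<theta>)"

definition gaussian_family :: "real \<Rightarrow> real \<Rightarrow> real \<Rightarrow> real" where
  "gaussian_family \<sigma> = (\<lambda>\<mu>. normal_density \<mu> \<sigma>)"

definition gaussian_mechanism :: "real \<Rightarrow> ('a list \<Rightarrow> real) \<Rightarrow> 'a list \<Rightarrow> real \<Rightarrow> real" where
  "gaussian_mechanism \<sigma> h D x =
     1 / sqrt (2 * pi * \<sigma>\<^sup>2) * exp (- (x - h D)\<^sup>2 / (2 * \<sigma>\<^sup>2))"

lemma normal_density_eq_iff:
  assumes "\<sigma> > 0"
  shows "normal_density \<mu>\<^sub>1 \<sigma> = normal_density \<mu>\<^sub>2 \<sigma> \<longleftrightarrow> \<mu>\<^sub>1 = \<mu>\<^sub>2"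
proof
  assume "normal_density \<mu>\<^sub>1 \<sigma> = normal_density \<mu>\<^sub>2 \<sigma>"
  then have "normal_density \<mu>\<^sub>1 \<sigma> \<mu>\<^sub>1 = normal_density \<mu>\<^sub>2 \<sigma> \<mu>\<^sub>1" by simp
  then show "\<mu>\<^sub>1 = \<mu>\<^sub>2" using assms by (simp add: normal_density_def)
qed simp

lemma rao_dist_normal_density:
  assumes "\<sigma> > 0"
  shows "rao_dist (gaussian_family \<sigma>) (normal_density \<mu>\<^sub>1 \<sigma>) (normal_density \<mu>\<^sub>2 \<sigma>) =
           riemannian_dist (fisher_information (gaussian_family \<sigma>)) \<mu>\<^sub>1 \<mu>\<^sub>2"
  using assms by (simp add: rao_dist_def gaussian_family_def normal_density_eq_iff)

end

theory Submission
  imports Defs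
begin

text \<open>For fixed \<open>\<sigma>\<close> the Fisher information does not depend on the mean: it
  is the constant 1/\<open>\<sigma>\<close>^2 (\<open>fisher_information_gaussian_family\<close>).
  The parameter line thus carries a rescaled Euclidean metric, and the straight segment from a to b
  has length |a - b|/\<open>\<sigma>\<close>. As the Rao distance is an infimum over paths, this one
  path bounds it (\<open>riemannian_dist_const_le\<close>). For adjacent datasets the means differ
  by at most the sensitivity, which is at most \<open>\<theta>\<close> times
  \<open>\<sigma>\<close>.\<close>

lemma gaussian_score:
  assumes "\<sigma> > 0"
  shows "deriv (\<lambda>m. ln (gaussian_family \<sigma> m x)) \<mu> = (x - \<mu>) / \<sigma>\<^sup>2"
proof -
  have "ln (gaussian_family \<sigma> m x) = - ln (sqrt (2 * pi * \<sigma>\<^sup>2)) - (x - m)\<^sup>2 / (2 * \<sigma>\<^sup>2)" for m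
    using assms by (simp add: gaussian_family_def normal_density_def ln_mult ln_div)
  moreover have "((\<lambda>m. - ln (sqrt (2 * pi * \<sigma>\<^sup>2)) - (x - m)\<^sup>2 / (2 * \<sigma>\<^sup>2)) 
      has_real_derivative (x - \<mu>) / \<sigma>\<^sup>2) (at \<mu>)"
    using assms by (auto intro!: derivative_eq_intros simp: field_simps)
  ultimately show ?thesis
    by (simp add: DERIV_imp_deriv)
qed

text \<open>The score is the centred observation divided by \<open>\<sigma>\<close>^2, so its second
  moment is the variance divided by \<open>\<sigma>\<close>^4.\<close>

lemma fisher_information_gaussian_family:
  assumes "\<sigma> > 0"
  shows "fisher_information (gaussian_family \<sigma>) \<mu> = 1 / \<sigma>\<^sup>2"
proof -
  have "fisher_information (gaussian_family \<sigma>) \<mu> =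
      (\<integral>x. ((x - \<mu>) / \<sigma>\<^sup>2)\<^sup>2 \<partial>density lborel (normal_density \<mu> \<sigma>))"
    by (simp add: fisher_information_def gaussian_score[OF assms])
      (simp add: gaussian_family_def)
  also have "\<dots> = (\<integral>x. normal_density \<mu> \<sigma> x * (x - \<mu>)\<^sup>2 / \<sigma> ^ 4 \<partial>lborel)"
    by (subst integral_density) (simp_all add: power_divide)
  also have "\<dots> = \<sigma>\<^sup>2 / \<sigma> ^ 4"
    \<comment> \<open>The even central moment of order 2 * 1 is the variance.\<close>
    using has_bochner_integral_integral_eq[OF normal_moment_even[OF assms, of \<mu> 1]] by simp
  also have "\<dots> = 1 / \<sigma>\<^sup>2"
    using assms by (simp add: field_simps power2_eq_square power4_eq_xxxx)
  finally show ?thesis .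
qed

lemma smooth_path_line: "smooth_path (\<lambda>t. a + t * (b - a))"
proof -
  \<comment> \<open>The whole sequence of derivatives of an affine map: itself, its slope, then
    zero.\<close>
  define d where "d k = (case k of 0 \<Rightarrow> \<lambda>t. a + t * (b - a) | Suc 0 \<Rightarrow> \<lambda>t. b - a | _ \<Rightarrow> \<lambda>t. 0)"
    for k :: nat
  have "(d k has_real_derivative d (Suc k) t) (at t within {0..1})" for k t
    by (auto simp: d_def split: nat.split intro!: derivative_eq_intros)
  then show ?thesis
    unfolding smooth_path_def by (intro exI[of _ d]) (simp add: d_def)
qed

text \<open>The segment is traversed at constant speed, so its length is the integral of a constant
  over an interval of measure one.\<close>

lemma riemannian_dist_const_le:
  "riemannian_dist (\<lambda>_. c) a b \<le> ennreal (sqrt c * \<bar>b - a\<bar>)"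
proof -
  let ?\<alpha> = "\<lambda>t. a + t * (b - a)"
  \<comment> \<open>The line is differentiable on all of the reals, so the one-sided derivatives at
    0 and 1 agree with the ordinary one.\<close>
  have "vector_derivative ?\<alpha> (at t within {0..1}) = b - a" if "t \<in> {0..1}" for t :: real
    using that
    by (intro vector_derivative_at_within_ivl)
      (auto intro!: derivative_eq_intros simp flip: has_real_derivative_iff_has_vector_derivative)
  then have "riemannian_length (\<lambda>_. c) ?\<alpha> =
      (\<integral>\<^sup>+t\<in>{0..1::real}. ennreal (sqrt c * \<bar>b - a\<bar>) \<partial>lborel)"
    unfolding riemannian_length_def
    by (auto intro!: set_nn_integral_cong)
  also have "\<dots> = ennreal (sqrt c * \<bar>b - a\<bar>)"
    by (simp add: nn_integral_cmult_indicator)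
  finally have "riemannian_length (\<lambda>_. c) ?\<alpha> = ennreal (sqrt c * \<bar>b - a\<bar>)" .
  then show ?thesis
    unfolding riemannian_dist_def
    by (intro INF_lower2[of ?\<alpha>]) (auto simp: smooth_path_line)
qed

lemma rao_dist_normal_density_le:
  assumes "\<sigma> > 0"
  shows "rao_dist (gaussian_family \<sigma>) (normal_density a \<sigma>) (normal_density b \<sigma>)
    \<le> ennreal (\<bar>a - b\<bar> / \<sigma>)"
proof -
  have "fisher_information (gaussian_family \<sigma>) = (\<lambda>_. 1 / \<sigma>\<^sup>2)"
    using fisher_information_gaussian_family[OF assms] by blast
  then show ?thesis
    using riemannian_dist_const_le[of "1 / \<sigma>\<^sup>2" a b] assms
    by (simp add: rao_dist_normal_density real_sqrt_divide abs_minus_commute)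
qed

theorem theorem4p8:
  fixes X :: "'a set" and n :: nat and h :: "'a list \<Rightarrow> real" and \<theta> \<sigma> :: real
  assumes "\<theta> > 0" and "\<sigma> > 0"
    and "ennreal \<sigma> \<ge> sensitivity X n h / ennreal \<theta>"
  shows "rao_differentially_private (gaussian_family \<sigma>) X n \<theta> (gaussian_mechanism \<sigma> h)"
  unfolding rao_differentially_private_def
proof clarify
  fix D D'
  assume adj: "(D, D') \<in> adjacent_datasets X n"
  \<comment> \<open>The outputs must be recognised as members of the family, with parameter
    \<open>h E\<close>, for \<open>rao_dist\<close> to be finite.\<close>
  have mechanism: "gaussian_mechanism \<sigma> h E = normal_density (h E) \<sigma>" for E
    by (auto simp: gaussian_mechanism_def normal_density_def)
  have "ennreal \<bar>h D - h D'\<bar> \<le> sensitivity X n h"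
    unfolding sensitivity_def by (rule SUP_upper2[OF adj]) simp
  then have "ennreal \<bar>h D - h D'\<bar> / ennreal \<theta> \<le> sensitivity X n h / ennreal \<theta>"
    by (rule divide_right_mono_ennreal)
  with assms(3) have "ennreal \<bar>h D - h D'\<bar> / ennreal \<theta> \<le> ennreal \<sigma>"
    by (rule order_trans[rotated])
  \<comment> \<open>Positivity of \<open>\<theta>\<close> and \<open>\<sigma>\<close> lets the
    \<open>ennreal\<close> inequality descend to the reals, where the two can be exchanged.\<close>
  then have "\<bar>h D - h D'\<bar> / \<sigma> \<le> \<theta>"
    using assms(1,2) by (simp add: divide_ennreal field_simps)
  then show "rao_dist (gaussian_family \<sigma>) (gaussian_mechanism \<sigma> h D) (gaussian_mechanism \<sigma> h D')
      \<le> ennreal \<theta>"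
    unfolding mechanism
    using rao_dist_normal_density_le[OF assms(2)] ennreal_leI order_trans by blast
qed

end
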